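(* For any bounded lattice $L$ and binary operation $\to$ on $L$, the following are equivalent: 1. $\to$ is a preconditional such that $a\wedge(a\to 0)=0$ and $(a\to 0)\to 0=a$ for all $a\in L$; 2. $L$ equipped with the unary operation $\neg$ defined by $\neg a:=a\to 0$ is an ortholattice, and $\to$ coincides with the Sasaki hook, i.e., $a\to b=\neg a\vee(a\wedge b)$ for all $a,b\in L$.
   Context: A preconditional on a bounded lattice $L$ is a binary operation $\to$ on $L$ such that for all $a,b,c\in L$: (1) $1\to a\leq a$; (2) $a\wedge b\leq a\to b$; (3) $a\to b\leq a\to(a\wedge b)$; (4) $a\to(b\wedge c)\leq a\to b$; (5) $a\to((a\wedge b)\to c)\leq (a\wedge b)\to c$. An ortholattice is a bounded lattice equipped with a unary operation $\neg$ (an orthocomplementation) satisfying antitonicity ($a\leq b$ implies $\neg b\leq\neg a$), semicomplementation ($a\wedge\neg a=0$), and involution ($\neg\neg a=a$). *)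

theory Defs
  imports "HOL-Library.Complemented_Lattices"
begin

unbundle lattice_syntax

locale preconditional =
  fixes imp :: "'a::bounded_lattice \<Rightarrow> 'a \<Rightarrow> 'a"  (infixr "\<leadsto>" 60)
  assumes top_imp: "(\<top> \<leadsto> a) \<le> a"
    and inf_le_imp: "a \<sqinter> b \<le> (a \<leadsto> b)"
    and imp_le_imp_inf: "(a \<leadsto> b) \<le> (a \<leadsto> (a \<sqinter> b))"
    and imp_inf_le: "(a \<leadsto> (b \<sqinter> c)) \<le> (a \<leadsto> b)"
    and imp_imp_le: "(a \<leadsto> ((a \<sqinter> b) \<leadsto> c)) \<le> ((a \<sqinter> b) \<leadsto> c)"

text \<open>
  The complement is a parameter here, whereas the class \<^class>\<open>orthocomplemented_lattice\<close>
  fixes it to be \<^const>\<open>uminus\<close>, and moreover demands a difference operation and the law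
  \<open>x \<squnion> - x = \<top>\<close>, which follows from the three axioms below.
\<close>

locale ortholattice =
  fixes neg :: "'a::bounded_lattice \<Rightarrow> 'a"
  assumes antitone: "a \<le> b \<Longrightarrow> neg b \<le> neg a"
    and semicomplement: "a \<sqinter> neg a = \<bottom>"
    and involution: "neg (neg a) = a"

lemma ortholattice_iff_orthocomplemented_lattice:
  "ortholattice neg \<longleftrightarrow>
    class.orthocomplemented_lattice (\<lambda>x y. x \<sqinter> neg y) neg (\<sqinter>) (\<le>) (<) (\<squnion>) \<bottom> \<top>"
proof
  assume "ortholattice neg"
  then interpret ortholattice neg .
  have "x \<squnion> neg x = \<top>" for x
  proof -
    have "neg (x \<squnion> neg x) \<le> neg x \<sqinter> neg (neg x)"
      by (simp add: antitone)
    then have "neg (x \<squnion> neg x) = \<bottom>"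
      by (simp add: semicomplement le_bot)
    moreover have "neg \<top> = \<bottom>"
      using semicomplement [of \<top>] by simp
    ultimately show ?thesis
      by (metis involution)
  qed
  then show "class.orthocomplemented_lattice (\<lambda>x y. x \<sqinter> neg y) neg (\<sqinter>) (\<le>) (<) (\<squnion>) \<bottom> \<top>"
    by unfold_locales (simp_all add: semicomplement involution antitone)
next
  assume "class.orthocomplemented_lattice (\<lambda>x y. x \<sqinter> neg y) neg (\<sqinter>) (\<le>) (<) (\<squnion>) \<bottom> \<top>"
  then interpret l: orthocomplemented_lattice
    "\<lambda>x y. x \<sqinter> neg y" neg "(\<sqinter>)" "(\<le>)" "(<)" "(\<squnion>)" \<bottom> \<top> .
  show "ortholattice neg"
    by unfold_locales (simp_all add: l.ortho_antimono)
qed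

definition sasaki_hook :: "('a::bounded_lattice \<Rightarrow> 'a) \<Rightarrow> 'a \<Rightarrow> 'a \<Rightarrow> 'a"
  where "sasaki_hook neg a b = neg a \<squnion> (a \<sqinter> b)"

end

theory Submission
  imports Defs
begin

text \<open>
  The fifth axiom says that \<open>a \<leadsto> x \<le> x\<close> whenever \<open>x = (d \<leadsto> c)\<close> with \<open>d \<le> a\<close>. For
  \<open>c = \<bottom>\<close> it makes \<open>\<not>\<close> antitone. With involution it also bounds \<open>a \<leadsto> b\<close> by the Sasaki hook:
  \<open>x = \<not> (a \<sqinter> \<not> (a \<sqinter> b))\<close> lies above \<open>a \<sqinter> b\<close>, and \<open>x = \<not> a \<squnion> (a \<sqinter> b)\<close> by De Morgan, so
  \<open>a \<leadsto> b \<le> a \<leadsto> (a \<sqinter> b) \<le> a \<leadsto> x \<le> x\<close>.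
\<close>

context ortholattice
begin

lemma neg_top: "neg \<top> = \<bottom>"
  using semicomplement [of \<top>] by simp

text \<open>The half of De Morgan used for the upper bound: \<open>neg\<close> of the join lies
  below both \<open>a\<close> and \<open>neg b\<close>, and a second negation turns the inequality
  around.\<close>

lemma neg_inf_neg_le: "neg (a \<sqinter> neg b) \<le> neg a \<squnion> b"
proof -
  have "neg (neg a \<squnion> b) \<le> a \<sqinter> neg b"
    using antitone [of "neg a" "neg a \<squnion> b"] antitone [of b "neg a \<squnion> b"]
    by (simp add: involution)
  from antitone [OF this] show ?thesis
    by (simp add: involution)
qed

lemma preconditional_sasaki_hook: "preconditional (sasaki_hook neg)"
proof
  fix a b c :: 'a
  show "sasaki_hook neg \<top> a \<le> a"
    by (simp add: sasaki_hook_def neg_top)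
  show "a \<sqinter> b \<le> sasaki_hook neg a b"
    by (simp add: sasaki_hook_def)
  show "sasaki_hook neg a b \<le> sasaki_hook neg a (a \<sqinter> b)"
    by (simp add: sasaki_hook_def)
  show "sasaki_hook neg a (b \<sqinter> c) \<le> sasaki_hook neg a b"
    unfolding sasaki_hook_def by (intro sup_mono inf_mono order_refl inf_le1)
  \<comment> \<open>For the fifth axiom, let \<open>x\<close> be the inner hook. The outer hook is
    \<open>neg a \<squnion> (a \<sqinter> x)\<close>, and both joinands lie below
    \<open>x\<close>.\<close>
  have "neg a \<le> sasaki_hook neg (a \<sqinter> b) c"
    unfolding sasaki_hook_def by (intro le_supI1 antitone inf_le1)
  then show "sasaki_hook neg a (sasaki_hook neg (a \<sqinter> b) c) \<le> sasaki_hook neg (a \<sqinter> b) c"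
    by (simp add: sasaki_hook_def [of neg a])
qed

end

context preconditional
begin

lemma imp_mono: "b \<le> c \<Longrightarrow> (a \<leadsto> b) \<le> (a \<leadsto> c)"
  using imp_inf_le [of a c b] by (simp add: inf_absorb2)

lemma imp_imp_le_of_le: "b \<le> a \<Longrightarrow> (a \<leadsto> (b \<leadsto> c)) \<le> (b \<leadsto> c)"
  using imp_imp_le [of a b c] by (simp add: inf_absorb2)

text \<open>Insert \<open>a \<leadsto> (b \<leadsto> \<bottom>)\<close> between the two sides:
  monotonicity gives the first inequality, the fifth axiom the second.\<close>

lemma imp_bot_antitone:
  assumes "b \<le> a"
  shows "(a \<leadsto> \<bottom>) \<le> (b \<leadsto> \<bottom>)"
  using order_trans [OF imp_mono imp_imp_le_of_le] assms bot_least by blast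

lemma imp_eq_sasaki_hook:
  assumes "ortholattice (\<lambda>a. a \<leadsto> \<bottom>)"
  shows "(a \<leadsto> b) = sasaki_hook (\<lambda>a. a \<leadsto> \<bottom>) a b"
proof (rule antisym)
  interpret ortholattice "\<lambda>a. a \<leadsto> \<bottom>" by fact
  let ?d = "a \<sqinter> ((a \<sqinter> b) \<leadsto> \<bottom>)"
  have "(((a \<sqinter> b) \<leadsto> \<bottom>) \<leadsto> \<bottom>) \<le> (?d \<leadsto> \<bottom>)"
    by (rule antitone) simp
  then have "a \<sqinter> b \<le> (?d \<leadsto> \<bottom>)"
    by (simp only: involution)
  then have "(a \<leadsto> (a \<sqinter> b)) \<le> (a \<leadsto> (?d \<leadsto> \<bottom>))"
    by (rule imp_mono)
  also have "\<dots> \<le> (?d \<leadsto> \<bottom>)"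
    by (rule imp_imp_le_of_le) simp
  also have "\<dots> \<le> (a \<leadsto> \<bottom>) \<squnion> (a \<sqinter> b)"
    by (rule neg_inf_neg_le)
  finally show "(a \<leadsto> b) \<le> sasaki_hook (\<lambda>a. a \<leadsto> \<bottom>) a b"
    using imp_le_imp_inf [of a b] unfolding sasaki_hook_def by (rule order_trans [rotated])
  \<comment> \<open>Both joinands lie below \<open>a \<leadsto> b\<close>:
    \<open>a \<leadsto> \<bottom>\<close> by monotonicity, \<open>a \<sqinter> b\<close> by the
    second axiom.\<close>
  show "sasaki_hook (\<lambda>a. a \<leadsto> \<bottom>) a b \<le> (a \<leadsto> b)"
    by (simp add: sasaki_hook_def imp_mono inf_le_imp)
qed

end

theorem proposition4:
  fixes imp :: "'a::bounded_lattice \<Rightarrow> 'a \<Rightarrow> 'a"  (infixr "\<leadsto>" 60)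
  shows "(preconditional (\<leadsto>) \<and>
           (\<forall>a. a \<sqinter> (a \<leadsto> \<bottom>) = \<bottom>) \<and> (\<forall>a. ((a \<leadsto> \<bottom>) \<leadsto> \<bottom>) = a))
         \<longleftrightarrow>
         (ortholattice (\<lambda>a. a \<leadsto> \<bottom>) \<and>
           (\<forall>a b. (a \<leadsto> b) = sasaki_hook (\<lambda>a. a \<leadsto> \<bottom>) a b))"
    (is "?L \<longleftrightarrow> ?R")
proof
  assume ?L
  then interpret preconditional "(\<leadsto>)" by blast
  have ol: "ortholattice (\<lambda>a. a \<leadsto> \<bottom>)"
    using \<open>?L\<close> by unfold_locales (auto intro: imp_bot_antitone)
  then show ?R
    using imp_eq_sasaki_hook by blast
next
  assume ?R
  then interpret ortholattice "\<lambda>a. a \<leadsto> \<bottom>" by blast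
  have "(\<leadsto>) = sasaki_hook (\<lambda>a. a \<leadsto> \<bottom>)"
    using \<open>?R\<close> by (intro ext) blast
  then have "preconditional (\<leadsto>)"
    using preconditional_sasaki_hook by metis
  then show ?L
    using semicomplement involution by blast
qed

end
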